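(* Let $G$ and $H$ be connected graphs and let $f:V(G)\to V(H)$ be any non-constant function. Then $$\sum_{u,v} d_H(f(u),f(v))^2 d_u d_v\ \le\ \frac{\mathrm{vol}(G)^2 D_H^2}{2}\left(1-\frac{1}{|V(H)|}\right),$$ where the sum is over unordered pairs $\{u,v\}$ of vertices of $G$.
   Context: Graphs are finite and simple; $d_u$ is the degree of $u$ in $G$, $\mathrm{vol}(G)=\sum_{u\in V(G)}d_u$, $d_H$ is the shortest-path distance in $H$, and $D_H$ is the diameter of $H$. *)

theory Defs
  imports "Graph_Theory.Graph_Theory"
begin

text \<open>
  Finite simple graphs are the locale \<open>graph\<close> of Graph_Theory: finite, loop-free, symmetric
  digraphs without parallel arcs.  An undirected edge is a pair of opposite arcs, so the degree
  of \<open>u\<close> is \<open>out_degree G u\<close>.  Its \<open>connected\<close> excludes the null graph.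
\<close>

definition vol :: "('a, 'b) pre_digraph \<Rightarrow> nat" where
  "vol G = (\<Sum>u\<in>verts G. out_degree G u)"

text \<open>
  The length of a walk is its cost for unit weights.  The value \<open>\<infinity>\<close> of \<open>\<mu>\<close> for unreachable
  vertices would be sent to \<open>0\<close>; this does not occur between vertices of a connected graph.
\<close>

definition graph_dist :: "('a, 'b) pre_digraph \<Rightarrow> 'a \<Rightarrow> 'a \<Rightarrow> real" where
  "graph_dist G u v = real_of_ereal (wf_digraph.\<mu> G (\<lambda>_. 1) u v)"

definition diameter :: "('a, 'b) pre_digraph \<Rightarrow> real" where
  "diameter G = Max {graph_dist G u v | u v. u \<in> verts G \<and> v \<in> verts G}"

text \<open>
  The sum of \<open>w u v\<close> over the unordered pairs of distinct elements of \<open>V\<close>.  The description is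
  well defined only for symmetric \<open>w\<close>, see \<open>pair_value_eq\<close> below.
\<close>

definition pair_value :: "('a \<Rightarrow> 'a \<Rightarrow> real) \<Rightarrow> 'a set \<Rightarrow> real" where
  "pair_value w e = (THE x. \<exists>u v. e = {u, v} \<and> x = w u v)"

definition sum_pairs :: "('a \<Rightarrow> 'a \<Rightarrow> real) \<Rightarrow> 'a set \<Rightarrow> real" where
  "sum_pairs w V = (\<Sum>e | e \<subseteq> V \<and> card e = 2. pair_value w e)"

lemma pair_value_eq:
  assumes "w u v = w v u"
  shows "pair_value w {u, v} = w u v"
  unfolding pair_value_def
  by (rule the_equality) (use assms in \<open>auto simp: doubleton_eq_iff\<close>)

lemma (in wf_digraph) awalk_cost_unit: "awalk_cost (\<lambda>_. 1) p = real (length p)"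
  by (induction p) auto

lemma (in sym_digraph) awalk_reverse:
  assumes "awalk u p v"
  shows "\<exists>q. awalk v q u \<and> length q = length p"
  using assms
proof (induction p arbitrary: u)
  case Nil
  then show ?case
    by (auto simp: awalk_Nil_iff)
next
  case (Cons e p)
  then have e: "e \<in> arcs G" "tail G e = u" and p: "awalk (head G e) p v"
    by (auto simp: awalk_Cons_iff)
  from Cons.IH[OF p] obtain q where q: "awalk v q (head G e)" "length q = length p"
    by blast
  from sym_arcs e obtain e' where "e' \<in> arcs G" "tail G e' = head G e" "head G e' = u"
    unfolding symmetric_conv by metis
  then have "awalk (head G e) [e'] u"
    by (auto simp: awalk_Cons_iff awalk_Nil_iff)
  with q have "awalk v (q @ [e']) u"
    by (auto intro: awalk_appendI)
  with q show ?case
    by (intro exI[of _ "q @ [e']"]) simp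
qed

lemma (in sym_digraph) graph_dist_commute: "graph_dist G u v = graph_dist G v u"
proof -
  have le: "\<mu> (\<lambda>_. 1) x y \<le> \<mu> (\<lambda>_. 1) y x" for x y
    unfolding \<mu>_def
  proof (rule INF_mono)
    fix p assume "p \<in> {p. awalk y p x}"
    with awalk_reverse obtain q where "awalk x q y" "length q = length p"
      by blast
    then show "\<exists>q\<in>{p. awalk x p y}. ereal (awalk_cost (\<lambda>_. 1) q) \<le> ereal (awalk_cost (\<lambda>_. 1) p)"
      by (auto simp: awalk_cost_unit)
  qed
  show ?thesis
    unfolding graph_dist_def by (simp add: antisym[OF le le])
qed

lemma (in fin_digraph) graph_dist_shortest_path:
  assumes "u \<rightarrow>\<^sup>* v"
  shows "\<exists>p. apath u p v \<and> graph_dist G u v = length p \<and>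
    (\<forall>q. awalk u q v \<longrightarrow> length p \<le> length q)"
proof -
  from min_cost_awalk[OF assms, of "\<lambda>_. 1"] obtain p
    where p: "apath u p v" "\<mu> (\<lambda>_. 1) u v = awalk_cost (\<lambda>_. 1) p"
    by auto
  have "length p \<le> length q" if "awalk u q v" for q
    using min_cost_le_walk_cost[OF that, of "\<lambda>_. 1"] p by (simp add: awalk_cost_unit)
  with p show ?thesis
    by (auto simp: graph_dist_def awalk_cost_unit)
qed

end

theory Submission
  imports Defs "HOL-Analysis.Convex"
begin

text \<open>
  Over ordered pairs, those with \<open>f u = f v\<close> contribute nothing and every other pair at most
  \<open>(diameter H)\<^sup>2 * d u * d v\<close>.  The pairs with \<open>f u = f v\<close> have total weight
  \<open>\<Sum>x. (m x)\<^sup>2\<close>, where \<open>m x\<close> is the volume of the fibre over \<open>x\<close>; by Cauchy-Schwarz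
  this is at least \<open>(vol G)\<^sup>2 / card (verts H)\<close>.
\<close>

text \<open>Mapping \<open>(u, v)\<close> to \<open>{u, v}\<close> groups the ordered pairs. Over
  each two-element set lie exactly two of them, and by symmetry both carry the value
  \<open>pair_value w e\<close>.\<close>

lemma sum_pairs_double:
  assumes "finite V" and sym: "\<And>u v. w u v = w v u"
  shows "2 * sum_pairs w V = (\<Sum>(u, v) | u \<in> V \<and> v \<in> V \<and> u \<noteq> v. w u v)"
proof -
  let ?S = "{(u, v). u \<in> V \<and> v \<in> V \<and> u \<noteq> v}"
  let ?T = "{e. e \<subseteq> V \<and> card e = 2}"
  have fS: "finite ?S"
    by (rule finite_subset[of _ "V \<times> V"]) (use assms in auto)
  have fT: "finite ?T"
    by (rule finite_subset[of _ "Pow V"]) (use assms in auto)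
  have "(\<lambda>(u, v). {u, v}) ` ?S \<subseteq> ?T"
    by auto
  then have "(\<Sum>(u, v)\<in>?S. w u v)
      = (\<Sum>e\<in>?T. \<Sum>(u, v) | (u, v) \<in> ?S \<and> {u, v} = e. w u v)"
    using sum.group[OF fS fT, of "\<lambda>(u, v). {u, v}" "\<lambda>(u, v). w u v"]
    by (simp add: case_prod_unfold conj_ac)
  also have "\<dots> = (\<Sum>e\<in>?T. 2 * pair_value w e)"
  proof (rule sum.cong[OF refl])
    fix e assume "e \<in> ?T"
    then obtain x y where e: "e = {x, y}" "x \<noteq> y" "x \<in> V" "y \<in> V"
      by (auto simp: card_2_iff)
    then have "{(u, v). (u, v) \<in> ?S \<and> {u, v} = e} = {(x, y), (y, x)}"
      by (auto simp: doubleton_eq_iff)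
    with e show "(\<Sum>(u, v) | (u, v) \<in> ?S \<and> {u, v} = e. w u v) = 2 * pair_value w e"
      by (simp add: pair_value_eq[of w, OF sym] sym[of y x])
  qed
  finally show ?thesis
    by (simp add: sum_pairs_def sum_distrib_left)
qed

text \<open>Cauchy-Schwarz against the constant 1 on \<open>B\<close>, applied to the sums of
  \<open>m\<close> over the fibres of \<open>f\<close>. The square of a fibre sum expands into the
  ordered pairs inside that fibre. Fibres may be empty, as \<open>f\<close> need not map onto
  \<open>B\<close>.\<close>

lemma square_sum_le_card_fibres:
  fixes m :: "'a \<Rightarrow> real"
  assumes "finite A" "finite B" "f ` A \<subseteq> B"
  shows "(\<Sum>u\<in>A. m u)\<^sup>2 \<le> card B * (\<Sum>(u, v) | u \<in> A \<and> v \<in> A \<and> f u = f v. m u * m v)"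
proof -
  let ?F = "\<lambda>x. {u \<in> A. f u = x}"
  let ?S = "{(u, v). u \<in> A \<and> v \<in> A \<and> f u = f v}"
  have fS: "finite ?S"
    by (rule finite_subset[of _ "A \<times> A"]) (use assms in auto)
  have "(\<Sum>u\<in>A. m u)\<^sup>2 = (\<Sum>x\<in>B. sum m (?F x))\<^sup>2"
    by (simp add: sum.group[OF assms])
  also have "\<dots> \<le> card B * (\<Sum>x\<in>B. (sum m (?F x))\<^sup>2)"
    using sum_squared_le_sum_of_squares[of "\<lambda>x. sum m (?F x)" B] by (simp add: mult.commute)
  also have "(\<Sum>x\<in>B. (sum m (?F x))\<^sup>2) = (\<Sum>x\<in>B. \<Sum>(u, v) | (u, v) \<in> ?S \<and> f u = x. m u * m v)"
  proof (rule sum.cong[OF refl])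
    fix x
    have "?F x \<times> ?F x = {(u, v). (u, v) \<in> ?S \<and> f u = x}"
      by auto
    then show "(sum m (?F x))\<^sup>2 = (\<Sum>(u, v) | (u, v) \<in> ?S \<and> f u = x. m u * m v)"
      by (simp add: power2_eq_square sum_product sum.cartesian_product)
  qed
  \<comment> \<open>Both entries of a pair in \<open>?S\<close> lie in the same fibre, so
    \<open>f \<circ> fst\<close> alone tells which one.\<close>
  also have "\<dots> = (\<Sum>(u, v)\<in>?S. m u * m v)"
    using sum.group[OF fS assms(2), of "f \<circ> fst" "\<lambda>(u, v). m u * m v"] assms(3)
    by (auto simp: case_prod_unfold image_subset_iff)
  finally show ?thesis by simp
qed

lemma (in fin_digraph) graph_dist_self:
  assumes "u \<in> verts G"
  shows "graph_dist G u u = 0"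
proof -
  have "awalk u [] u"
    using assms by (simp add: awalk_Nil_iff)
  with graph_dist_shortest_path[of u u] assms show ?thesis
    by fastforce
qed

lemma (in fin_digraph) graph_dist_nonneg:
  assumes "u \<rightarrow>\<^sup>* v"
  shows "0 \<le> graph_dist G u v"
  using graph_dist_shortest_path[OF assms] by auto

lemma (in fin_digraph) graph_dist_le_diameter:
  assumes "u \<in> verts G" "v \<in> verts G"
  shows "graph_dist G u v \<le> diameter G"
proof -
  \<comment> \<open>As an image of a finite product the set is visibly finite, as
    \<open>Max_ge\<close> requires.\<close>
  have "{graph_dist G u v | u v. u \<in> verts G \<and> v \<in> verts G}
      = (\<lambda>(u, v). graph_dist G u v) ` (verts G \<times> verts G)"
    by auto
  then show ?thesis
    unfolding diameter_def using assms by (intro Max_ge) auto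
qed

theorem theorem3p3:
  fixes G :: "('a, 'b) pre_digraph" and H :: "('c, 'd) pre_digraph" and f :: "'a \<Rightarrow> 'c"
  assumes "graph G" and "connected G"
    and "graph H" and "connected H"
    and "f ` verts G \<subseteq> verts H"
    and "\<not> (\<exists>c. \<forall>u\<in>verts G. f u = c)"
  shows "sum_pairs (\<lambda>u v. (graph_dist H (f u) (f v))\<^sup>2 *
            real (out_degree G u) * real (out_degree G v)) (verts G)
    \<le> (real (vol G))\<^sup>2 * (diameter H)\<^sup>2 / 2 * (1 - 1 / real (card (verts H)))"
proof -
  interpret G: graph G by fact
  interpret H: graph H by fact
  let ?V = "verts G" and ?n = "real (card (verts H))"
  let ?d = "\<lambda>u. real (out_degree G u)"
  let ?w = "\<lambda>u v. (graph_dist H (f u) (f v))\<^sup>2 * ?d u * ?d v"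
  let ?N = "{(u, v). u \<in> ?V \<and> v \<in> ?V \<and> f u \<noteq> f v}"
  let ?E = "{(u, v). u \<in> ?V \<and> v \<in> ?V \<and> f u = f v}"
  have fin: "finite ?N" "finite ?E"
    by (rule finite_subset[of _ "?V \<times> ?V"]; auto)+
  have n: "?n > 0"
    using \<open>connected H\<close> by (auto simp: connected_def strongly_connected_def card_gt_0_iff)
  have dist: "(graph_dist H x y)\<^sup>2 \<le> (diameter H)\<^sup>2" if "x \<in> verts H" "y \<in> verts H" for x y
  proof -
    \<comment> \<open>Squaring preserves the bound only for nonnegative distances, and nonnegativity
      is derived from reachability. Since \<open>H\<close> is symmetric, connectedness yields
      directed walks.\<close>
    have "x \<rightarrow>\<^sup>*\<^bsub>H\<^esub> y"
      using H.symmetric_connected_imp_strongly_connected[OF H.sym_arcs \<open>connected H\<close>] that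
      by (auto simp: strongly_connected_def)
    then show ?thesis
      using that by (intro power_mono H.graph_dist_le_diameter H.graph_dist_nonneg)
  qed
  have sym: "?w u v = ?w v u" for u v
    using H.graph_dist_commute[of "f u" "f v"] by simp
  have "2 * sum_pairs ?w ?V = (\<Sum>(u, v) | u \<in> ?V \<and> v \<in> ?V \<and> u \<noteq> v. ?w u v)"
    by (rule sum_pairs_double[OF G.finite_verts sym])
  \<comment> \<open>Pairs with \<open>u \<noteq> v\<close> but \<open>f u = f v\<close> have
    distance 0 in \<open>H\<close>; conversely \<open>f u \<noteq> f v\<close> forces
    \<open>u \<noteq> v\<close>.\<close>
  also have "\<dots> = (\<Sum>(u, v)\<in>?N. ?w u v)"
    by (rule sum.mono_neutral_right)
      (use assms(5) in \<open>auto intro!: H.graph_dist_self intro: finite_subset[of _ "?V \<times> ?V"]\<close>)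
  also have "\<dots> \<le> (\<Sum>(u, v)\<in>?N. (diameter H)\<^sup>2 * (?d u * ?d v))"
    using assms(5) by (intro sum_mono) (auto simp: mult.assoc intro!: mult_right_mono dist)
  also have "\<dots> = (diameter H)\<^sup>2 * (\<Sum>(u, v)\<in>?N. ?d u * ?d v)"
    by (simp add: sum_distrib_left case_prod_unfold)
  also have "\<dots> \<le> (diameter H)\<^sup>2 * ((real (vol G))\<^sup>2 * (1 - 1 / ?n))"
  proof (rule mult_left_mono)
    have "(real (vol G))\<^sup>2 = (\<Sum>(u, v)\<in>?V \<times> ?V. ?d u * ?d v)"
      by (simp add: vol_def power2_eq_square sum_product sum.cartesian_product)
    \<comment> \<open>The diagonal pairs, absent from the sum being bounded, belong to
      \<open>?E\<close>. This makes \<open>?E\<close> the full set of pairs in a common fibre, to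
      which the Cauchy-Schwarz bound applies.\<close>
    also have "?V \<times> ?V = ?N \<union> ?E"
      by auto
    also have "(\<Sum>(u, v)\<in>?N \<union> ?E. ?d u * ?d v)
        = (\<Sum>(u, v)\<in>?N. ?d u * ?d v) + (\<Sum>(u, v)\<in>?E. ?d u * ?d v)"
      by (rule sum.union_disjoint) (use fin in auto)
    finally have split: "(real (vol G))\<^sup>2 = \<dots>" .
    have "(real (vol G))\<^sup>2 \<le> ?n * (\<Sum>(u, v)\<in>?E. ?d u * ?d v)"
      using square_sum_le_card_fibres[OF G.finite_verts H.finite_verts assms(5), of ?d]
      by (simp add: vol_def)
    then have "(real (vol G))\<^sup>2 / ?n \<le> (\<Sum>(u, v)\<in>?E. ?d u * ?d v)"
      using n by (simp add: divide_le_eq mult.commute)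
    with split show "(\<Sum>(u, v)\<in>?N. ?d u * ?d v) \<le> (real (vol G))\<^sup>2 * (1 - 1 / ?n)"
      by (simp add: right_diff_distrib)
  qed simp
  \<comment> \<open>The chain bounds twice the sum over unordered pairs, hence the division by
    2.\<close>
  finally show ?thesis
    by (simp add: mult_ac)
qed

end
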